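(* Let $d\ge 1$, $\delta>0$, and let $\omega_1,\omega_2,\dots$ be i.i.d. random vectors with values in $[0,1]^d$ and common law $P$, where $P$ admits a density with respect to Lebesgue measure on $[0,1]^d$ bounded by a constant $B$. Let $I\subset\mathbb{Z}^e$ be a finite set ($1\le e\le d$) and $\Lambda$ a neighborhood function on $I-I$. Let $\beta:\mathbb{N}^*\to(0,+\infty)$ satisfy $\lim_{n\to+\infty}\beta(n)=+\infty$. With $V$ the extended variance and $V_n$ the empirical extended variance of $\omega_1,\dots,\omega_n$, set $$\bar\chi_n^\beta:=\left\{x\in D_I^\delta:\ V_n(x)<\inf_{y\in D_I^\delta}V_n(y)+\frac{1}{\beta(n)}\right\},\qquad \bar\chi:=\arg\min_{x\in D_I^\delta}V(x),$$ where $\bar\chi$ denotes the set of all minimizers of $V$ on $D_I^\delta$. Then the quasi-estimators of minimum extended variance are strongly consistent: for every neighborhood $\mathcal{N}$ of $\bar\chi$ in $D_I^\delta$, almost surely there exists $n_0$ such that $\bar\chi_n^\beta\subset\mathcal{N}$ for all $n\ge n_0$.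
   Context: $\|\cdot\|$ is the Euclidean norm. $I\subset\mathbb{Z}^e$ is finite, with $e\in\mathbb{N}^*$, $e\le d$. A neighborhood function is a map $\Lambda$ from $I-I:=\{i-j:\ i,j\in I\}$ to $[0,1]$ such that $\Lambda(k)=\Lambda(-k)$ for all $k$ and $\Lambda(0)=1$. The set of admissible centroid vectors is $$D_I^\delta:=\left\{x=(x_i)_{i\in I}\in([0,1]^d)^I:\ \|x_i-x_j\|\ge\delta\ \text{ if } i\ne j\right\},$$ with the topology induced by the Euclidean topology of $([0,1]^d)^I$. A neighborhood of $\bar\chi$ in $D_I^\delta$ is a subset of $D_I^\delta$ containing a relatively open subset of $D_I^\delta$ that contains $\bar\chi$. Voronoi tessellation: for $x\in D_I^\delta$ and $i\in I$, $C_i(x)$ is the set of $\omega\in[0,1]^d$ with $\|x_i-\omega\|<\|x_j-\omega\|$ for all $j\ne i$; in case of ties (several indices minimizing $\|x_i-\omega\|$), $\omega$ is assigned to exactly one of the tied cells using the lexicographic order on $I$ (say, the lexicographically smallest tied index). Thus $(C_i(x))_{i\in I}$ is a Borel partition of $[0,1]^d$. The extended variance is $$V(x):=\frac12\sum_{i,j\in I}\Lambda(i-j)\int_{C_i(x)}\|x_j-\omega\|^2\,dP(\omega),$$ and the empirical extended variance of the observations $\omega_1,\dots,\omega_n$ is $$V_n(x):=\frac{1}{2n}\sum_{i\in I}\ \sum_{1\le k\le n,\ \omega_k\in C_i(x)}\left(\sum_{j\in I}\Lambda(i-j)\|x_j-\omega_k\|^2\right).$$ *)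

theory Defs
  imports "HOL-Probability.Probability" "HOL-Library.Fun_Lexorder"
begin

text \<open>
  Indices live in \<open>int ^ 'e\<close>, points in \<open>real ^ 'd\<close>. The \<open>linorder\<close> on \<open>'e\<close> only
  orders the coordinates (identifying \<open>'e\<close> with \<open>{1..e}\<close>), as the lexicographic order requires.
  The unit cube is \<open>cbox 0 1\<close>, where \<open>1\<close> is the vector all of whose coordinates are 1.
\<close>

type_synonym 'e index_vec = "(int, 'e) vec"

definition neighborhood_function ::
    "('e::finite) index_vec set \<Rightarrow> ('e index_vec \<Rightarrow> real) \<Rightarrow> bool" where
  "neighborhood_function I \<Lambda> \<longleftrightarrow>
     (\<forall>k \<in> {i - j | i j. i \<in> I \<and> j \<in> I}. \<Lambda> k \<in> {0..1} \<and> \<Lambda> k = \<Lambda> (- k)) \<and> \<Lambda> 0 = 1"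

text \<open>Families indexed by \<open>I\<close> are functions extensional outside \<open>I\<close>.\<close>

definition centroid_set ::
    "('e::finite) index_vec set \<Rightarrow> real \<Rightarrow> ('e index_vec \<Rightarrow> real ^ 'd::finite) set" where
  "centroid_set I \<delta> =
     {x \<in> I \<rightarrow>\<^sub>E cbox 0 1. \<forall>i\<in>I. \<forall>j\<in>I. i \<noteq> j \<longrightarrow> \<delta> \<le> norm (x i - x j)}"

text \<open>As \<open>I\<close> is finite, the product topology below is the Euclidean topology of the finite power.\<close>

definition centroid_topology ::
    "('e::finite) index_vec set \<Rightarrow> real \<Rightarrow> ('e index_vec \<Rightarrow> real ^ 'd::finite) topology" where
  "centroid_topology I \<delta> =
     subtopology (product_topology (\<lambda>_. euclidean) I) (centroid_set I \<delta>)"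

definition is_neighborhood :: "'a topology \<Rightarrow> 'a set \<Rightarrow> 'a set \<Rightarrow> bool" where
  "is_neighborhood T A N \<longleftrightarrow>
     N \<subseteq> topspace T \<and> (\<exists>U. openin T U \<and> A \<subseteq> U \<and> U \<subseteq> N)"

definition lex_less :: "('e::{finite,linorder}) index_vec \<Rightarrow> 'e index_vec \<Rightarrow> bool" where
  "lex_less i j \<longleftrightarrow> less_fun (\<lambda>k. i $ k) (\<lambda>k. j $ k)"

text \<open>Ties are attributed to the lexicographically smallest index attaining the minimum.\<close>

definition voronoi_cell ::
    "('e::{finite,linorder}) index_vec set \<Rightarrow> ('e index_vec \<Rightarrow> real ^ 'd::finite) \<Rightarrow> 'e index_vec
      \<Rightarrow> (real ^ 'd) set" where
  "voronoi_cell I x i =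
     {\<omega> \<in> cbox 0 1.
        (\<forall>j\<in>I. norm (x i - \<omega>) \<le> norm (x j - \<omega>)) \<and>
        (\<forall>j\<in>I. norm (x j - \<omega>) = norm (x i - \<omega>) \<longrightarrow> \<not> lex_less j i)}"

definition ext_variance ::
    "('e::{finite,linorder}) index_vec set \<Rightarrow> ('e index_vec \<Rightarrow> real) \<Rightarrow> (real ^ 'd::finite) measure
      \<Rightarrow> ('e index_vec \<Rightarrow> real ^ 'd) \<Rightarrow> real" where
  "ext_variance I \<Lambda> P x =
     1 / 2 * (\<Sum>i\<in>I. \<Sum>j\<in>I.
       \<Lambda> (i - j) * (LINT \<omega>:voronoi_cell I x i|P. (norm (x j - \<omega>))\<^sup>2))"

definition emp_ext_variance ::
    "('e::{finite,linorder}) index_vec set \<Rightarrow> ('e index_vec \<Rightarrow> real) \<Rightarrow> (nat \<Rightarrow> real ^ 'd::finite) \<Rightarrow> nat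
      \<Rightarrow> ('e index_vec \<Rightarrow> real ^ 'd) \<Rightarrow> real" where
  "emp_ext_variance I \<Lambda> obs n x =
     1 / (2 * real n) *
       (\<Sum>i\<in>I. \<Sum>k\<in>{k \<in> {1..n}. obs k \<in> voronoi_cell I x i}.
          \<Sum>j\<in>I. \<Lambda> (i - j) * (norm (x j - obs k))\<^sup>2)"

definition quasi_estimators ::
    "('e::{finite,linorder}) index_vec set \<Rightarrow> real \<Rightarrow> ('e index_vec \<Rightarrow> real) \<Rightarrow> (nat \<Rightarrow> real)
      \<Rightarrow> (nat \<Rightarrow> real ^ 'd::finite) \<Rightarrow> nat \<Rightarrow> ('e index_vec \<Rightarrow> real ^ 'd) set" where
  "quasi_estimators I \<delta> \<Lambda> \<beta> obs n =
     {x \<in> centroid_set I \<delta>.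
        emp_ext_variance I \<Lambda> obs n x
          < (INF y \<in> centroid_set I \<delta>. emp_ext_variance I \<Lambda> obs n y) + 1 / \<beta> n}"

definition optimal_centroids ::
    "('e::{finite,linorder}) index_vec set \<Rightarrow> real \<Rightarrow> ('e index_vec \<Rightarrow> real) \<Rightarrow> (real ^ 'd::finite) measure
      \<Rightarrow> ('e index_vec \<Rightarrow> real ^ 'd) set" where
  "optimal_centroids I \<delta> \<Lambda> P =
     {x. is_arg_min (ext_variance I \<Lambda> P) (\<lambda>y. y \<in> centroid_set I \<delta>) x}"

end

theory Submission
  imports Defs
begin

text \<open>
  The extended variance is the mean of the pointwise loss \<open>ext_loss\<close>. Shrinking the Voronoi cells
  and the distances by a margin \<open>\<eta>\<close> gives a minorant of the loss that is valid simultaneously for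
  all centroid vectors \<open>\<eta>\<close>-close to \<open>x\<close>, and whose mean tends to the extended variance at \<open>x\<close>
  because the bisecting hyperplanes are null. So, as in Wald's consistency argument, only a lower
  bound on the empirical variance is needed: cover the compact complement of a neighborhood of the
  minimizers by finitely many such balls and apply the strong law of large numbers to the finitely
  many minorants and to the loss at one minimizer.
\<close>

section \<open>Strong law for bounded variables\<close>

text \<open>Hoeffding's inequality makes the probability of a deviation of size \<epsilon> decay
  geometrically in \<open>n\<close>, so Borel-Cantelli leaves only finitely many such deviations
  almost surely. The countably many tolerances \<open>1 / real (Suc m)\<close> then share one null
  set.\<close>

lemma (in prob_space) bounded_strong_law:
  fixes X :: "nat \<Rightarrow> 'a \<Rightarrow> real"
  assumes indep: "indep_vars (\<lambda>_. borel) X {1..}"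
    and distr: "\<And>n. n \<ge> 1 \<Longrightarrow> distr M borel (X n) = distr M borel Y"
    and Y [measurable]: "Y \<in> borel_measurable M"
    and bd: "\<And>s. s \<in> space M \<Longrightarrow> Y s \<in> {a..b}"
  shows "AE s in M. (\<lambda>n. (\<Sum>k=1..n. X k s) / real n) \<longlonglongrightarrow> expectation Y"
proof -
  \<comment> \<open>Enlarging the range to \<open>b + 1\<close> gives the interval positive length
    even when \<open>Y\<close> is constant, so that \<open>q < 1\<close> below.\<close>
  have bd': "Y s \<in> {a..b + 1}" if "s \<in> space M" for s
    using bd[OF that] by auto
  have ab: "a < b + 1"
    using bd not_empty by fastforce
  have X [measurable]: "X n \<in> borel_measurable M" if "n \<ge> 1" for n
    using indep that unfolding indep_vars_def by auto
  have *: "AE s in M. \<forall>\<^sub>F n in sequentially. \<bar>(\<Sum>k=1..n. X k s) / real n - expectation Y\<bar> < \<epsilon>"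
    if "\<epsilon> > 0" for \<epsilon>
  proof -
    define A where "A n = {s \<in> space M. \<bar>(\<Sum>k=1..n. X k s) / real n - expectation Y\<bar> \<ge> \<epsilon>}" for n
    define q where "q = exp (- 2 * \<epsilon>\<^sup>2 / (b + 1 - a)\<^sup>2)"
    have A: "A n \<in> sets M" for n
    proof -
      have [measurable]: "(\<lambda>s. \<Sum>k=1..n. X k s) \<in> borel_measurable M"
        by (intro borel_measurable_sum X) auto
      show ?thesis unfolding A_def by measurable
    qed
    have le: "prob (A n) \<le> 2 * q ^ n" for n
    proof (cases "n = 0")
      case True
      \<comment> \<open>The empty average falls outside Hoeffding's inequality, but here the bound
        is 2 and holds trivially.\<close>
      then show ?thesis using prob_le_1[of "A n"] by (simp del: prob_le_1)
    next
      case False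
      interpret Hoeffding_ineq_iid M "{1..n}" X Y a "b + 1" "expectation Y"
      proof unfold_locales
        show "indep_vars (\<lambda>_. borel) X {1..n}"
          by (rule indep_vars_subset[OF indep]) auto
        show "AE x in M. Y x \<in> {a..b + 1}"
          using bd' by auto
      qed (auto intro: distr)
      have "prob (A n) \<le> 2 * exp (- 2 * real n * \<epsilon>\<^sup>2 / (b + 1 - a)\<^sup>2)"
        using Hoeffding_ineq_abs_ge'[of \<epsilon>] that ab False by (simp add: A_def)
      also have "exp (- 2 * real n * \<epsilon>\<^sup>2 / (b + 1 - a)\<^sup>2) = q ^ n"
        unfolding q_def exp_of_nat_mult[symmetric] by (simp add: algebra_simps)
      finally show ?thesis .
    qed
    have q: "0 < q" "q < 1"
      using that ab by (auto simp: q_def divide_simps)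
    have "summable (\<lambda>n. 2 * q ^ n)"
      using q by (intro summable_mult summable_geometric) auto
    then have "summable (\<lambda>n. prob (A n))"
      by (rule summable_comparison_test_ev[rotated]) (use le in auto)
    then have "AE s in M. \<forall>\<^sub>F n in sequentially. s \<in> space M - A n"
      by (intro borel_cantelli_AE1 A) (auto simp: less_top[symmetric])
    then show ?thesis
      by eventually_elim (auto simp: A_def elim!: eventually_mono)
  qed
  have "AE s in M. \<forall>m. \<forall>\<^sub>F n in sequentially.
      \<bar>(\<Sum>k=1..n. X k s) / real n - expectation Y\<bar> < 1 / real (Suc m)"
    unfolding AE_all_countable by (intro allI *) simp
  then show ?thesis
  proof eventually_elim
    case (elim s)
    show ?case
    proof (rule tendstoI)
      fix e :: real assume "e > 0"
      then obtain m where m: "1 / real (Suc m) < e"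
        using nat_approx_posE by blast
      show "\<forall>\<^sub>F n in sequentially. dist ((\<Sum>k=1..n. X k s) / real n) (expectation Y) < e"
        using elim[rule_format, of m] by eventually_elim (use m in \<open>auto simp: dist_real_def\<close>)
    qed
  qed
qed

text \<open>The form in which the strong law is applied to losses of the observations, with the
  limit expressed through the common law \<open>P\<close>. Boundedness on the whole space is
  available there because the losses vanish outside the cube.\<close>

lemma (in prob_space) bounded_strong_law_comp:
  fixes W :: "nat \<Rightarrow> 'a \<Rightarrow> 'b::topological_space" and h :: "'b \<Rightarrow> real"
  assumes indep: "indep_vars (\<lambda>_. borel) W {1..}"
    and distr: "\<And>n. n \<ge> 1 \<Longrightarrow> distr M borel (W n) = P"
    and h [measurable]: "h \<in> borel_measurable borel"
    and bd: "\<And>w. h w \<in> {a..b}"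
  shows "AE s in M. (\<lambda>n. (\<Sum>k=1..n. h (W k s)) / real n) \<longlonglongrightarrow> integral\<^sup>L P h"
proof -
  have W [measurable]: "W n \<in> borel_measurable M" if "n \<ge> 1" for n
    using indep that unfolding indep_vars_def by auto
  have W1 [measurable]: "W 1 \<in> borel_measurable M" by (rule W) simp
  have "distr M borel (\<lambda>s. h (W n s)) = distr P borel h" if "n \<ge> 1" for n
    using distr_distr[OF h W[OF that]] distr[OF that] by (simp add: o_def)
  then have eq: "distr M borel (\<lambda>s. h (W n s)) = distr M borel (\<lambda>s. h (W 1 s))" if "n \<ge> 1" for n
    using that by simp
  have "indep_vars (\<lambda>_. borel) (\<lambda>n s. h (W n s)) {1..}"
    by (rule indep_vars_compose2[OF indep]) (rule h)
  from bounded_strong_law[OF this eq _ bd]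
  have "AE s in M. (\<lambda>n. (\<Sum>k=1..n. h (W k s)) / real n) \<longlonglongrightarrow> expectation (\<lambda>s. h (W 1 s))"
    by measurable
  also have "expectation (\<lambda>s. h (W 1 s)) = integral\<^sup>L P h"
    using integral_distr[OF W1 h] distr[of 1] by simp
  finally show ?thesis .
qed

section \<open>The space of centroid vectors\<close>

lemma topspace_centroid [simp]: "topspace (centroid_topology I \<delta>) = centroid_set I \<delta>"
  by (auto simp: centroid_topology_def centroid_set_def)

text \<open>An intersection of closed sets; the empty index set is separate because
  \<open>\<Inter>\<close> over it is \<open>UNIV\<close> rather than the space.\<close>

lemma closedin_Collect_ball:
  assumes "\<And>i. i \<in> A \<Longrightarrow> closedin X {x \<in> topspace X. P i x}"
  shows "closedin X {x \<in> topspace X. \<forall>i\<in>A. P i x}"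
proof (cases "A = {}")
  case False
  then have "{x \<in> topspace X. \<forall>i\<in>A. P i x} = (\<Inter>i\<in>A. {x \<in> topspace X. P i x})"
    by blast
  then show ?thesis
    using False assms by (auto intro: closedin_INT)
qed simp

text \<open>A product of cubes is compact, and the separation constraints are non-strict
  inequalities between continuous functions, hence cut out a closed subset.\<close>

lemma compact_space_centroid:
  fixes I :: "('e::finite) index_vec set"
  shows "compact_space (centroid_topology I \<delta> :: ('e index_vec \<Rightarrow> real ^ 'd::finite) topology)"
proof -
  let ?X = "product_topology (\<lambda>_. euclidean) I :: ('e index_vec \<Rightarrow> real ^ 'd) topology"
  let ?D = "centroid_set I \<delta> :: ('e index_vec \<Rightarrow> real ^ 'd) set"
  have "compactin ?X (I \<rightarrow>\<^sub>E cbox 0 1)"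
    by (simp add: compactin_PiE)
  moreover have "closedin ?X ?D"
  proof -
    have "closedin ?X {x \<in> topspace ?X. \<forall>i\<in>I. x i \<in> cbox 0 1}"
      by (intro closedin_Collect_ball closedin_continuous_map_preimage[where Y = euclidean]
          continuous_map_product_projection) auto
    moreover have "closedin ?X {x \<in> topspace ?X. i \<noteq> j \<longrightarrow> norm (x i - x j) \<in> {\<delta>..}}"
      if "i \<in> I" "j \<in> I" for i j
    proof (cases "i = j")
      case False
      have "closedin ?X {x \<in> topspace ?X. norm (x i - x j) \<in> {\<delta>..}}"
        using that by (intro closedin_continuous_map_preimage[where Y = euclidean] continuous_intros) auto
      with False show ?thesis by simp
    qed (use closedin_topspace[of ?X] in simp)
    then have "closedin ?X {x \<in> topspace ?X. \<forall>i\<in>I. \<forall>j\<in>I. i \<noteq> j \<longrightarrow> norm (x i - x j) \<in> {\<delta>..}}"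
      by (intro closedin_Collect_ball)
    ultimately have "closedin ?X ({x \<in> topspace ?X. \<forall>i\<in>I. x i \<in> cbox 0 1} \<inter>
        {x \<in> topspace ?X. \<forall>i\<in>I. \<forall>j\<in>I. i \<noteq> j \<longrightarrow> norm (x i - x j) \<in> {\<delta>..}})"
      by (rule closedin_Int)
    also have "\<dots> = ?D"
      by (auto simp only: centroid_set_def PiE_iff topspace_product_topology topspace_euclidean
          Int_iff mem_Collect_eq UNIV_I atLeast_iff)
    finally show ?thesis .
  qed
  moreover have "?D \<subseteq> I \<rightarrow>\<^sub>E cbox 0 1"
    by (auto simp: centroid_set_def)
  ultimately have "compactin ?X ?D"
    using closed_compactin by blast
  then show ?thesis
    unfolding centroid_topology_def by (rule compact_space_subtopology)
qed

text \<open>The relatively open ball for the maximum metric: all centroids are controlled by the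
  same \<open>\<eta>\<close>, which is the margin used in the minorants.\<close>

definition centroid_ball ::
    "('e::finite) index_vec set \<Rightarrow> real \<Rightarrow> ('e index_vec \<Rightarrow> real ^ 'd::finite) \<Rightarrow> real
      \<Rightarrow> ('e index_vec \<Rightarrow> real ^ 'd) set" where
  "centroid_ball I \<delta> x \<eta> = {y \<in> centroid_set I \<delta>. \<forall>i\<in>I. dist (x i) (y i) < \<eta>}"

lemma openin_centroid_ball:
  fixes x :: "('e::finite) index_vec \<Rightarrow> real ^ 'd::finite"
  assumes "finite I"
  shows "openin (centroid_topology I \<delta>) (centroid_ball I \<delta> x \<eta>)"
proof -
  let ?T = "centroid_topology I \<delta> :: ('e index_vec \<Rightarrow> real ^ 'd) topology"
  have "openin ?T {y \<in> topspace ?T. y i \<in> ball (x i) \<eta>}" if "i \<in> I" for i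
  proof (rule openin_continuous_map_preimage)
    show "continuous_map ?T euclidean (\<lambda>y. y i)"
      using that unfolding centroid_topology_def
      by (intro continuous_map_from_subtopology continuous_map_product_projection)
  qed auto
  \<comment> \<open>Intersecting with the space keeps the formula correct when \<open>I\<close> is
    empty.\<close>
  then have "openin ?T (topspace ?T \<inter> (\<Inter>i\<in>I. {y \<in> topspace ?T. y i \<in> ball (x i) \<eta>}))"
    using assms openin_topspace[of ?T]
    by (cases "I = {}") (auto intro!: openin_Int openin_INT2 simp del: topspace_centroid)
  also have "\<dots> = centroid_ball I \<delta> x \<eta>"
    by (auto simp: centroid_ball_def)
  finally show ?thesis .
qed

lemma mem_centroid_ball_self: "x \<in> centroid_set I \<delta> \<Longrightarrow> 0 < \<eta> \<Longrightarrow> x \<in> centroid_ball I \<delta> x \<eta>"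
  by (simp add: centroid_ball_def)

text \<open>Closed sets of centroid vectors are compact. The radius may vary with the centre, since
  it will be chosen separately at each point by an approximation argument.\<close>

lemma finite_centroid_ball_cover:
  fixes K :: "(('e::finite) index_vec \<Rightarrow> real ^ 'd::finite) set"
  assumes I: "finite I" and K: "closedin (centroid_topology I \<delta>) K"
    and \<eta>: "\<And>x. x \<in> K \<Longrightarrow> 0 < \<eta> x"
  obtains F where "finite F" "F \<subseteq> K" "K \<subseteq> (\<Union>x\<in>F. centroid_ball I \<delta> x (\<eta> x))"
proof -
  have "compactin (centroid_topology I \<delta>) K"
    using closedin_compact_space[OF compact_space_centroid K] .
  moreover have "K \<subseteq> centroid_set I \<delta>"
    using closedin_subset[OF K] by simp
  then have "K \<subseteq> (\<Union>x\<in>K. centroid_ball I \<delta> x (\<eta> x))"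
    using \<eta> mem_centroid_ball_self by fastforce
  ultimately obtain \<F> where "finite \<F>" "\<F> \<subseteq> (\<lambda>x. centroid_ball I \<delta> x (\<eta> x)) ` K" "K \<subseteq> \<Union>\<F>"
    unfolding compactin_def using openin_centroid_ball[OF I] by (smt (verit) imageE)
  with finite_subset_image[of \<F> "\<lambda>x. centroid_ball I \<delta> x (\<eta> x)" K]
  obtain F where "finite F" "F \<subseteq> K" "\<F> = (\<lambda>x. centroid_ball I \<delta> x (\<eta> x)) ` F"
    by blast
  with \<open>K \<subseteq> \<Union>\<F>\<close> that show ?thesis by blast
qed

section \<open>The pointwise loss and its local minorants\<close>

text \<open>Indicators replace the choice of a cell, so that the loss is a function of a single
  observation whose integral and sample mean are the two variances. It is 0 outside the
  cube.\<close>

definition ext_loss ::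
    "('e::{finite,linorder}) index_vec set \<Rightarrow> ('e index_vec \<Rightarrow> real)
      \<Rightarrow> ('e index_vec \<Rightarrow> real ^ 'd::finite) \<Rightarrow> real ^ 'd \<Rightarrow> real" where
  "ext_loss I \<Lambda> x w =
     1 / 2 * (\<Sum>i\<in>I. \<Sum>j\<in>I. \<Lambda> (i - j) * (indicator (voronoi_cell I x i) w * (norm (x j - w))\<^sup>2))"

text \<open>The margin is \<open>2 * \<eta>\<close> because moving two centroids by less than
  \<open>\<eta>\<close> each changes the difference of their distances to \<open>w\<close> by less
  than that. For positive \<open>\<eta>\<close> these cells leave a strip around the bisectors
  uncovered.\<close>

definition inner_cell ::
    "('e::finite) index_vec set \<Rightarrow> ('e index_vec \<Rightarrow> real ^ 'd::finite) \<Rightarrow> real \<Rightarrow> 'e index_vec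
      \<Rightarrow> (real ^ 'd) set" where
  "inner_cell I x \<eta> i =
     {w \<in> cbox 0 1. \<forall>j\<in>I. j \<noteq> i \<longrightarrow> norm (x i - w) + 2 * \<eta> < norm (x j - w)}"

text \<open>The truncation at 0 precedes the squaring: the square of a negative
  \<open>norm (x j - w) - \<eta>\<close> could exceed the squared distance it has to minorize.
  Points in no inner cell contribute 0.\<close>

definition minorant_loss ::
    "('e::finite) index_vec set \<Rightarrow> ('e index_vec \<Rightarrow> real)
      \<Rightarrow> ('e index_vec \<Rightarrow> real ^ 'd::finite) \<Rightarrow> real \<Rightarrow> real ^ 'd \<Rightarrow> real" where
  "minorant_loss I \<Lambda> x \<eta> w =
     1 / 2 * (\<Sum>i\<in>I. \<Sum>j\<in>I.
       \<Lambda> (i - j) * (indicator (inner_cell I x \<eta> i) w * (max 0 (norm (x j - w) - \<eta>))\<^sup>2))"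

lemma neighborhood_function_bounds:
  assumes "neighborhood_function I \<Lambda>" "i \<in> I" "j \<in> I"
  shows "0 \<le> \<Lambda> (i - j)" "\<Lambda> (i - j) \<le> 1"
  using assms unfolding neighborhood_function_def by fastforce+

text \<open>By the triangle inequality each distance to \<open>w\<close> changes by less than
  \<open>\<eta>\<close>, so \<open>y i\<close> remains strictly nearest to \<open>w\<close> and no
  tie has to be broken.\<close>

lemma inner_cell_subset_voronoi_cell:
  assumes "i \<in> I" "\<forall>j\<in>I. dist (x j) (y j) < \<eta>"
  shows "inner_cell I x \<eta> i \<subseteq> voronoi_cell I y i"
proof
  fix w assume w: "w \<in> inner_cell I x \<eta> i"
  have less: "norm (y i - w) < norm (y j - w)" if "j \<in> I" "j \<noteq> i" for j
  proof -
    have "norm (x i - w) + 2 * \<eta> < norm (x j - w)"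
      using w that by (auto simp: inner_cell_def)
    moreover have "dist (x i) (y i) < \<eta>" "dist (x j) (y j) < \<eta>"
      using assms that by auto
    ultimately show ?thesis
      using dist_triangle2[of "y i" w "x i"] dist_triangle[of "x j" w "y j"]
      by (simp add: dist_norm norm_minus_commute)
  qed
  have "\<not> lex_less i i"
    by (auto simp: lex_less_def less_fun_def)
  moreover have "w \<in> cbox 0 1"
    using w by (auto simp: inner_cell_def)
  ultimately show "w \<in> voronoi_cell I y i"
    unfolding voronoi_cell_def using less by (smt (verit) mem_Collect_eq)
qed

text \<open>The comparison holds term by term, as the weights are nonnegative. The left side depends
  only on the centre \<open>x\<close>, so one minorant serves every \<open>y\<close> in the ball;
  this stands in for a uniform law of large numbers.\<close>

lemma minorant_loss_le_ext_loss:
  assumes \<Lambda>: "neighborhood_function I \<Lambda>" and y: "y \<in> centroid_ball I \<delta> x \<eta>"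
  shows "minorant_loss I \<Lambda> x \<eta> w \<le> ext_loss I \<Lambda> y w"
proof -
  have d: "\<forall>j\<in>I. dist (x j) (y j) < \<eta>"
    using y by (simp add: centroid_ball_def)
  have "indicator (inner_cell I x \<eta> i) w \<le> (indicator (voronoi_cell I y i) w :: real)" if "i \<in> I" for i
    using inner_cell_subset_voronoi_cell[OF that d] by (auto simp: indicator_def)
  moreover have "max 0 (norm (x j - w) - \<eta>) \<le> norm (y j - w)" if "j \<in> I" for j
    using d[rule_format, OF that] dist_triangle[of "x j" w "y j"] by (simp add: dist_norm)
  ultimately show ?thesis
    unfolding minorant_loss_def ext_loss_def
    by (intro mult_left_mono sum_mono mult_mono power_mono neighborhood_function_bounds[OF \<Lambda>]) auto
qed

lemma minorant_loss_nonneg: "neighborhood_function I \<Lambda> \<Longrightarrow> 0 \<le> minorant_loss I \<Lambda> x \<eta> w"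
  unfolding minorant_loss_def
  by (intro mult_nonneg_nonneg sum_nonneg) (auto intro: neighborhood_function_bounds)

lemma ext_loss_nonneg: "neighborhood_function I \<Lambda> \<Longrightarrow> 0 \<le> ext_loss I \<Lambda> x w"
  unfolding ext_loss_def
  by (intro mult_nonneg_nonneg sum_nonneg) (auto intro: neighborhood_function_bounds)

text \<open>Inside the cube every distance is at most its diameter, and outside all indicators
  vanish. The bound serves both as dominating constant and as range for the strong law.\<close>

lemma ext_loss_bounded:
  fixes I :: "('e::{finite,linorder}) index_vec set"
  assumes \<Lambda>: "neighborhood_function I \<Lambda>"
  shows "\<exists>b. \<forall>x\<in>centroid_set I \<delta>. \<forall>w :: real ^ 'd::finite. ext_loss I \<Lambda> x w \<le> b"
proof -
  define R where "R = diameter (cbox 0 1 :: (real ^ 'd) set)"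
  have "ext_loss I \<Lambda> x w \<le> 1 / 2 * (\<Sum>i\<in>I. \<Sum>j\<in>I. 1 * R\<^sup>2)"
    if x: "x \<in> centroid_set I \<delta>" for x :: "'e index_vec \<Rightarrow> real ^ 'd" and w
    unfolding ext_loss_def
  proof (intro mult_left_mono sum_mono mult_mono neighborhood_function_bounds[OF \<Lambda>])
    fix i j assume ij: "i \<in> I" "j \<in> I"
    show "indicator (voronoi_cell I x i) w * (norm (x j - w))\<^sup>2 \<le> R\<^sup>2"
    proof (cases "w \<in> cbox 0 1")
      case True
      have "x j \<in> cbox 0 1"
        using x ij by (auto simp: centroid_set_def PiE_iff)
      with True have "norm (x j - w) \<le> R"
        unfolding R_def using diameter_bounded_bound[OF bounded_cbox] by (metis dist_norm)
      then show ?thesis by (auto simp: indicator_def intro: power_mono)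
    next
      case False
      then have "w \<notin> voronoi_cell I x i" by (simp add: voronoi_cell_def)
      then show ?thesis by simp
    qed
  qed auto
  then show ?thesis by blast
qed

section \<open>Borel measurability of the cells and losses\<close>

lemma borel_voronoi_cell:
  assumes "finite I"
  shows "voronoi_cell I x i \<in> sets borel"
proof -
  have "voronoi_cell I x i = cbox 0 1 \<inter> {w \<in> space borel.
        (\<forall>j\<in>I. norm (x i - w) \<le> norm (x j - w)) \<and>
        (\<forall>j\<in>I. norm (x j - w) = norm (x i - w) \<longrightarrow> \<not> lex_less j i)}"
    by (auto simp: voronoi_cell_def)
  also have "\<dots> \<in> sets borel"
    using assms by (intro sets.Int) measurable
  finally show ?thesis .
qed

lemma borel_inner_cell:
  assumes "finite I"
  shows "inner_cell I x \<eta> i \<in> sets borel"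
proof -
  have "inner_cell I x \<eta> i = cbox 0 1 \<inter> {w \<in> space borel.
        \<forall>j\<in>I. j \<noteq> i \<longrightarrow> norm (x i - w) + 2 * \<eta> < norm (x j - w)}"
    by (auto simp: inner_cell_def)
  also have "\<dots> \<in> sets borel"
    using assms by (intro sets.Int) measurable
  finally show ?thesis .
qed

lemma borel_measurable_ext_loss:
  assumes "finite I"
  shows "ext_loss I \<Lambda> x \<in> borel_measurable borel"
proof -
  note borel_voronoi_cell[OF assms, measurable]
  show ?thesis unfolding ext_loss_def[abs_def] by measurable
qed

lemma borel_measurable_minorant_loss:
  assumes "finite I"
  shows "minorant_loss I \<Lambda> x \<eta> \<in> borel_measurable borel"
proof -
  note borel_inner_cell[OF assms, measurable]
  show ?thesis unfolding minorant_loss_def[abs_def] by measurable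
qed

section \<open>Convergence of the minorants off the bisectors\<close>

text \<open>Squaring both norms cancels the quadratic term in \<open>w\<close> and leaves the
  equation of a hyperplane with normal \<open>2 *\<^sub>R (a - b)\<close>, nonzero as the points
  differ.\<close>

lemma null_sets_bisector:
  fixes a b :: "'a::euclidean_space"
  assumes "a \<noteq> b"
  shows "{w. norm (a - w) = norm (b - w)} \<in> null_sets lborel"
proof -
  have "{w. norm (a - w) = norm (b - w)} = {w. (2 *\<^sub>R (a - b)) \<bullet> w = a \<bullet> a - b \<bullet> b}"
    by (auto simp: norm_eq inner_simps inner_commute algebra_simps)
  moreover have "negligible {w. (2 *\<^sub>R (a - b)) \<bullet> w = a \<bullet> a - b \<bullet> b}"
    using assms by (intro negligible_hyperplane) auto
  moreover have "{w. norm (a - w) = norm (b - w)} \<in> sets lborel"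
    by measurable
  ultimately show ?thesis
    using negligible_iff_null_sets null_sets_completion_iff by metis
qed

text \<open>Off the bisectors the nearest centroid wins by a positive gap, and there are finitely
  many gaps; once \<open>2 * \<eta> m\<close> is below all of them, the inner cell and the Voronoi
  cell agree at \<open>w\<close>. The truncated distances converge by continuity.\<close>

lemma minorant_loss_tendsto:
  assumes "finite I" and \<eta>: "\<eta> \<longlonglongrightarrow> 0" "\<And>m. 0 < \<eta> m"
    and off: "\<And>i j. i \<in> I \<Longrightarrow> j \<in> I \<Longrightarrow> i \<noteq> j \<Longrightarrow> norm (x i - w) \<noteq> norm (x j - w)"
  shows "(\<lambda>m. minorant_loss I \<Lambda> x (\<eta> m) w) \<longlonglongrightarrow> ext_loss I \<Lambda> x w"
proof -
  have "(\<lambda>m. indicator (inner_cell I x (\<eta> m) i) w) \<longlonglongrightarrow> (indicator (voronoi_cell I x i) w :: real)"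
    if i: "i \<in> I" for i
  proof (rule tendsto_eventually, cases "w \<in> voronoi_cell I x i")
    case True
    have "\<forall>\<^sub>F m in sequentially. \<forall>j\<in>I - {i}. norm (x i - w) + 2 * \<eta> m < norm (x j - w)"
    proof (rule eventually_ball_finite)
      show "\<forall>j\<in>I - {i}. \<forall>\<^sub>F m in sequentially. norm (x i - w) + 2 * \<eta> m < norm (x j - w)"
      proof
        fix j assume j: "j \<in> I - {i}"
        then have "norm (x i - w) + 2 * 0 < norm (x j - w)"
          using True off[of i j] i by (auto simp: voronoi_cell_def less_le)
        moreover have "(\<lambda>m. norm (x i - w) + 2 * \<eta> m) \<longlonglongrightarrow> norm (x i - w) + 2 * 0"
          by (intro tendsto_intros \<eta>)
        ultimately show "\<forall>\<^sub>F m in sequentially. norm (x i - w) + 2 * \<eta> m < norm (x j - w)"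
          using order_tendstoD(2) by blast
      qed
    qed (use assms in auto)
    then show "\<forall>\<^sub>F m in sequentially.
        indicator (inner_cell I x (\<eta> m) i) w = (indicator (voronoi_cell I x i) w :: real)"
    proof eventually_elim
      case (elim m)
      then have "w \<in> inner_cell I x (\<eta> m) i"
        using True by (auto simp: inner_cell_def voronoi_cell_def)
      with True show ?case by simp
    qed
  next
    case False
    \<comment> \<open>The inclusion of cells is applied to the unperturbed vector,
      \<open>y = x\<close>.\<close>
    then have "w \<notin> inner_cell I x (\<eta> m) i" for m
      using inner_cell_subset_voronoi_cell[of i I x x "\<eta> m"] i \<eta>(2) by auto
    with False show "\<forall>\<^sub>F m in sequentially.
        indicator (inner_cell I x (\<eta> m) i) w = (indicator (voronoi_cell I x i) w :: real)"
      by simp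
  qed
  moreover have "(\<lambda>m. max 0 (norm (x j - w) - \<eta> m)) \<longlonglongrightarrow> norm (x j - w)" for j
    using tendsto_max[OF tendsto_const tendsto_diff[OF tendsto_const \<eta>(1)], of 0 "norm (x j - w)"]
    by simp
  ultimately show ?thesis
    unfolding minorant_loss_def ext_loss_def by (intro tendsto_intros) auto
qed

section \<open>The empirical variance as a sample mean of losses\<close>

text \<open>Membership in a cell becomes an indicator and the sum over observations moves outside.
  Division by zero makes both sides 0 when \<open>n\<close> is 0.\<close>

lemma emp_ext_variance_eq:
  assumes "finite I"
  shows "emp_ext_variance I \<Lambda> obs n x = (\<Sum>k=1..n. ext_loss I \<Lambda> x (obs k)) / real n"
proof -
  have "(\<Sum>k\<in>{k \<in> {1..n}. obs k \<in> voronoi_cell I x i}. \<Sum>j\<in>I. \<Lambda> (i - j) * (norm (x j - obs k))\<^sup>2) =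
      (\<Sum>k=1..n. \<Sum>j\<in>I. \<Lambda> (i - j) * (indicator (voronoi_cell I x i) (obs k) * (norm (x j - obs k))\<^sup>2))"
    for i
    by (subst sum.inter_filter) (auto intro!: sum.cong simp: indicator_def)
  then have "emp_ext_variance I \<Lambda> obs n x = 1 / (2 * real n) * (\<Sum>i\<in>I. \<Sum>k=1..n. \<Sum>j\<in>I.
      \<Lambda> (i - j) * (indicator (voronoi_cell I x i) (obs k) * (norm (x j - obs k))\<^sup>2))"
    by (simp add: emp_ext_variance_def)
  also have "\<dots> = (\<Sum>k=1..n. ext_loss I \<Lambda> x (obs k)) / real n"
    unfolding ext_loss_def sum_distrib_left[symmetric] by (subst sum.swap) simp
  finally show ?thesis .
qed

lemma emp_ext_variance_nonneg:
  assumes "finite I" "neighborhood_function I \<Lambda>"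
  shows "0 \<le> emp_ext_variance I \<Lambda> obs n x"
  unfolding emp_ext_variance_eq[OF assms(1)]
  by (intro divide_nonneg_nonneg sum_nonneg ext_loss_nonneg assms) auto

section \<open>Lower semicontinuity and existence of minimizers\<close>

text \<open>Centroids and cells lie in the cube, so each summand is bounded by the squared diameter
  and hence integrable; the integral then passes through the finite sums.\<close>

lemma ext_variance_eq:
  fixes P :: "(real ^ 'd::finite) measure"
  assumes P: "prob_space P" "sets P = sets borel" and I: "finite I"
    and x: "x \<in> centroid_set I \<delta>"
  shows "ext_variance I \<Lambda> P x = integral\<^sup>L P (ext_loss I \<Lambda> x)"
proof -
  interpret prob_space P by fact
  note [measurable_cong] = P(2)
  have int: "integrable P (\<lambda>w. indicator (voronoi_cell I x i) w * (norm (x j - w))\<^sup>2)"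
    if ij: "i \<in> I" "j \<in> I" for i j
  proof (rule integrable_const_bound)
    note borel_voronoi_cell[OF I, measurable]
    show "(\<lambda>w. indicator (voronoi_cell I x i) w * (norm (x j - w))\<^sup>2) \<in> borel_measurable P"
      by measurable
    have "norm (indicator (voronoi_cell I x i) w * (norm (x j - w))\<^sup>2)
        \<le> (diameter (cbox 0 1 :: (real ^ 'd) set))\<^sup>2" for w
    proof (cases "w \<in> voronoi_cell I x i")
      case True
      moreover have "x j \<in> cbox 0 1"
        using x ij by (auto simp: centroid_set_def PiE_iff)
      ultimately have "norm (x j - w) \<le> diameter (cbox 0 1 :: (real ^ 'd) set)"
        using diameter_bounded_bound[OF bounded_cbox] by (metis (lifting) dist_norm mem_Collect_eq voronoi_cell_def)
      with True show ?thesis by (simp add: power_mono)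
    qed simp
    then show "AE w in P. norm (indicator (voronoi_cell I x i) w * (norm (x j - w))\<^sup>2)
        \<le> (diameter (cbox 0 1 :: (real ^ 'd) set))\<^sup>2" by simp
  qed
  show ?thesis
    unfolding ext_variance_def ext_loss_def set_lebesgue_integral_def
    using int by simp
qed

text \<open>Separated centroids are distinct, so absolute continuity makes all bisectors
  \<open>P\<close>-null. The minorants therefore converge almost everywhere to the loss, and
  dominated convergence brings their means above any \<open>c\<close> below the variance.\<close>

lemma ext_variance_lower_approx:
  fixes P :: "(real ^ 'd::finite) measure"
  assumes P: "prob_space P" "sets P = sets borel" and ac: "absolutely_continuous lborel P"
    and I: "finite I" and \<Lambda>: "neighborhood_function I \<Lambda>" and \<delta>: "0 < \<delta>"
    and x: "x \<in> centroid_set I \<delta>" and c: "c < ext_variance I \<Lambda> P x"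
  shows "\<exists>\<eta>>0. c < integral\<^sup>L P (minorant_loss I \<Lambda> x \<eta>)"
proof -
  interpret prob_space P by fact
  note [measurable_cong] = P(2)
  note borel_measurable_ext_loss[OF I, measurable] borel_measurable_minorant_loss[OF I, measurable]
  obtain b where b: "ext_loss I \<Lambda> x w \<le> b" for w
    using ext_loss_bounded[OF \<Lambda>] x by metis
  define \<eta> where "\<eta> m = 1 / real (Suc m)" for m
  have \<eta>: "\<eta> \<longlonglongrightarrow> 0" "\<And>m. 0 < \<eta> m"
    unfolding \<eta>_def using LIMSEQ_Suc[OF lim_1_over_n] by auto
  have "AE w in P. norm (x i - w) \<noteq> norm (x j - w)" if "i \<in> I" "j \<in> I" "i \<noteq> j" for i j
  proof -
    have "x i \<noteq> x j"
      using x \<delta> that by (fastforce simp: centroid_set_def)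
    then have "{w. norm (x i - w) = norm (x j - w)} \<in> null_sets P"
      using null_sets_bisector ac by (auto simp: absolutely_continuous_def)
    from AE_not_in[OF this] show ?thesis by simp
  qed
  then have "AE w in P. \<forall>i\<in>I. \<forall>j\<in>I. i \<noteq> j \<longrightarrow> norm (x i - w) \<noteq> norm (x j - w)"
    using I by (intro AE_finite_allI) (auto intro: AE_impI)
  then have "AE w in P. (\<lambda>m. minorant_loss I \<Lambda> x (\<eta> m) w) \<longlonglongrightarrow> ext_loss I \<Lambda> x w"
    by eventually_elim (intro minorant_loss_tendsto I \<eta>, auto)
  \<comment> \<open>Since \<open>x\<close> lies in each ball around itself, its own loss dominates
    all the minorants.\<close>
  moreover have "norm (minorant_loss I \<Lambda> x (\<eta> m) w) \<le> b" for m w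
    using minorant_loss_nonneg[OF \<Lambda>, of x "\<eta> m" w] b[of w]
      minorant_loss_le_ext_loss[OF \<Lambda> mem_centroid_ball_self[OF x \<eta>(2)[of m]], of w] by simp
  ultimately have "(\<lambda>m. integral\<^sup>L P (minorant_loss I \<Lambda> x (\<eta> m))) \<longlonglongrightarrow> integral\<^sup>L P (ext_loss I \<Lambda> x)"
    by (intro integral_dominated_convergence[where w = "\<lambda>_. b"]) auto
  then have "\<forall>\<^sub>F m in sequentially. c < integral\<^sup>L P (minorant_loss I \<Lambda> x (\<eta> m))"
    using c ext_variance_eq[OF P I x] by (simp add: order_tendstoD(1))
  then show ?thesis
    using \<eta>(2) by (auto simp: eventually_sequentially)
qed

text \<open>Together with \<open>ext_variance_lower_approx\<close> this is lower semicontinuity: a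
  number below the variance at \<open>x\<close> stays below it on a whole ball around
  \<open>x\<close>.\<close>

lemma integral_minorant_le_ext_variance:
  fixes P :: "(real ^ 'd::finite) measure"
  assumes P: "prob_space P" "sets P = sets borel"
    and I: "finite I" and \<Lambda>: "neighborhood_function I \<Lambda>"
    and y: "y \<in> centroid_ball I \<delta> x \<eta>"
  shows "integral\<^sup>L P (minorant_loss I \<Lambda> x \<eta>) \<le> ext_variance I \<Lambda> P y"
proof -
  interpret prob_space P by fact
  note [measurable_cong] = P(2)
  note borel_measurable_ext_loss[OF I, measurable]
  have yD: "y \<in> centroid_set I \<delta>"
    using y by (simp add: centroid_ball_def)
  obtain b where b: "ext_loss I \<Lambda> y w \<le> b" for w
    using ext_loss_bounded[OF \<Lambda>] yD by metis
  have "integrable P (ext_loss I \<Lambda> y)"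
    by (rule integrable_const_bound[where B = b]) (auto simp: b ext_loss_nonneg[OF \<Lambda>])
  then show ?thesis
    unfolding ext_variance_eq[OF P I yD]
    by (intro integral_mono') (auto intro: minorant_loss_le_ext_loss[OF \<Lambda> y] ext_loss_nonneg[OF \<Lambda>])
qed

text \<open>If each \<open>x\<close> were beaten by some \<open>better x\<close>, then by
  semicontinuity \<open>better x\<close> would beat a whole ball around \<open>x\<close>. Among the
  finitely many centres of a subcover, let \<open>z\<close> have the best \<open>better z\<close>;
  that vector lies in some ball and is beaten by the \<open>better\<close> of its centre, a
  contradiction.\<close>

lemma optimal_centroids_nonempty:
  fixes P :: "(real ^ 'd::finite) measure"
  assumes P: "prob_space P" "sets P = sets borel" and ac: "absolutely_continuous lborel P"
    and I: "finite I" and \<Lambda>: "neighborhood_function I \<Lambda>" and \<delta>: "0 < \<delta>"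
    and D: "centroid_set I \<delta> \<noteq> ({} :: ('e::{finite,linorder} index_vec \<Rightarrow> real ^ 'd) set)"
  shows "optimal_centroids I \<delta> \<Lambda> P \<noteq> {}"
proof (rule ccontr)
  let ?D = "centroid_set I \<delta> :: ('e index_vec \<Rightarrow> real ^ 'd) set"
  let ?V = "ext_variance I \<Lambda> P"
  assume "\<not> ?thesis"
  then have "\<forall>x\<in>?D. \<exists>x'\<in>?D. ?V x' < ?V x"
    by (auto simp: optimal_centroids_def is_arg_min_def)
  then obtain better where better: "\<And>x. x \<in> ?D \<Longrightarrow> better x \<in> ?D" "\<And>x. x \<in> ?D \<Longrightarrow> ?V (better x) < ?V x"
    by metis
  then have "\<forall>x\<in>?D. \<exists>\<eta>>0. ?V (better x) < integral\<^sup>L P (minorant_loss I \<Lambda> x \<eta>)"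
    using ext_variance_lower_approx[OF P ac I \<Lambda> \<delta>] by blast
  then obtain \<eta> where \<eta>: "\<And>x. x \<in> ?D \<Longrightarrow> 0 < \<eta> x"
      "\<And>x. x \<in> ?D \<Longrightarrow> ?V (better x) < integral\<^sup>L P (minorant_loss I \<Lambda> x (\<eta> x))"
    by metis
  have D_closed: "closedin (centroid_topology I \<delta>) ?D"
    using closedin_topspace[of "centroid_topology I \<delta>"] by simp
  obtain F where F: "finite F" "F \<subseteq> ?D" "?D \<subseteq> (\<Union>x\<in>F. centroid_ball I \<delta> x (\<eta> x))"
    using finite_centroid_ball_cover[OF I D_closed \<eta>(1)] .
  with D have "F \<noteq> {}" by auto
  then obtain z where z: "z \<in> F" "\<And>x. x \<in> F \<Longrightarrow> ?V (better z) \<le> ?V (better x)"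
    using ex_is_arg_min_if_finite[OF F(1), of "\<lambda>x. ?V (better x)"] by (auto simp: is_arg_min_linorder)
  then obtain x where x: "x \<in> F" "better z \<in> centroid_ball I \<delta> x (\<eta> x)"
    using F better(1) by blast
  have "?V (better x) < ?V (better z)"
    using \<eta>(2) integral_minorant_le_ext_variance[OF P I \<Lambda> x(2)] x(1) F(2) by fastforce
  with z(2)[OF x(1)] show False by simp
qed

section \<open>Consistency\<close>

theorem mainTheorem1:
  fixes M :: "'a measure"
    and \<omega> :: "nat \<Rightarrow> 'a \<Rightarrow> real ^ 'd::finite"
    and P :: "(real ^ 'd) measure"
    and f :: "real ^ 'd \<Rightarrow> real"
    and B \<delta> :: real
    and I :: "('e::{finite,linorder}) index_vec set"
    and \<Lambda> :: "'e index_vec \<Rightarrow> real"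
    and \<beta> :: "nat \<Rightarrow> real"
    and N :: "('e index_vec \<Rightarrow> real ^ 'd) set"
  assumes "CARD('e) \<le> CARD('d)"
    and "\<delta> > 0"
    and "prob_space M"
    and "\<And>n s. n \<ge> 1 \<Longrightarrow> s \<in> space M \<Longrightarrow> \<omega> n s \<in> cbox 0 1"
    and "prob_space.indep_vars M (\<lambda>_. borel) \<omega> {1..}"
    and "\<And>n. n \<ge> 1 \<Longrightarrow> distr M borel (\<omega> n) = P"
    and "f \<in> borel_measurable borel"
    and "\<And>w. w \<in> cbox 0 1 \<Longrightarrow> 0 \<le> f w \<and> f w \<le> B"
    and "P = density lborel (\<lambda>w. ennreal (f w) * indicator (cbox 0 1) w)"
    and "finite I"
    and "neighborhood_function I \<Lambda>"
    and "\<And>n. n \<ge> 1 \<Longrightarrow> \<beta> n > 0"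
    and "filterlim \<beta> at_top sequentially"
    and "is_neighborhood (centroid_topology I \<delta>) (optimal_centroids I \<delta> \<Lambda> P) N"
  shows "AE s in M. \<exists>n0. \<forall>n\<ge>n0. quasi_estimators I \<delta> \<Lambda> \<beta> (\<lambda>k. \<omega> k s) n \<subseteq> N"
proof (cases "centroid_set I \<delta> = ({} :: ('e index_vec \<Rightarrow> real ^ 'd) set)")
  \<comment> \<open>When the separation constraint cannot be met there are no quasi-estimators, and
    the inclusion is trivial.\<close>
  case True
  then show ?thesis by (simp add: quasi_estimators_def)
next
  case False
  let ?D = "centroid_set I \<delta> :: ('e index_vec \<Rightarrow> real ^ 'd) set"
  let ?V = "ext_variance I \<Lambda> P"
  let ?Vn = "\<lambda>s. emp_ext_variance I \<Lambda> (\<lambda>k. \<omega> k s)"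
  let ?avg = "\<lambda>h s n. (\<Sum>k=1..n. h (\<omega> k s)) / real n"
  let ?h = "minorant_loss I \<Lambda>"
  interpret prob_space M by fact
  note I = \<open>finite I\<close> and \<Lambda> = \<open>neighborhood_function I \<Lambda>\<close>
  have [measurable]: "\<omega> 1 \<in> borel_measurable M"
    using assms(5) by (auto simp: indep_vars_def)
  have "prob_space (distr M borel (\<omega> 1))"
    by (rule prob_space_distr) measurable
  then have P: "prob_space P" "sets P = sets borel"
    by (simp_all only: assms(6) order.refl) (simp add: assms(9))
  have ac: "absolutely_continuous lborel P"
    unfolding assms(9) using assms(7)
    by (intro absolutely_continuousI_density borel_measurable_times borel_measurable_indicator) simp_all
  obtain U where U: "openin (centroid_topology I \<delta>) U" "optimal_centroids I \<delta> \<Lambda> P \<subseteq> U" "U \<subseteq> N"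
    using assms(14) by (auto simp: is_neighborhood_def)
  obtain xm where xm: "xm \<in> optimal_centroids I \<delta> \<Lambda> P"
    using optimal_centroids_nonempty[OF P ac I \<Lambda> \<open>\<delta> > 0\<close> False] by blast
  then have xmD: "xm \<in> ?D" and xm_le: "\<And>y. y \<in> ?D \<Longrightarrow> ?V xm \<le> ?V y"
    by (auto simp: optimal_centroids_def is_arg_min_linorder)
  \<comment> \<open>The set to be avoided; it is closed and contains no minimizer, so the variance
    there strictly exceeds its minimum.\<close>
  define K where "K = ?D - U"
  have K: "closedin (centroid_topology I \<delta>) K"
    unfolding K_def using U(1) closedin_diff[OF closedin_topspace U(1)] by simp
  have "?V xm < ?V x" if "x \<in> K" for x
  proof -
    have "x \<notin> optimal_centroids I \<delta> \<Lambda> P" "x \<in> ?D"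
      using that U(2) by (auto simp: K_def)
    then obtain y where "y \<in> ?D" "?V y < ?V x"
      by (auto simp: optimal_centroids_def is_arg_min_def)
    with xm_le show ?thesis by fastforce
  qed
  moreover have "K \<subseteq> ?D" by (auto simp: K_def)
  \<comment> \<open>The minimum itself is the level \<open>c\<close>, so every centre in
    \<open>K\<close> gets a minorant whose mean still exceeds the minimum.\<close>
  ultimately have "\<forall>x\<in>K. \<exists>\<eta>>0. ?V xm < integral\<^sup>L P (?h x \<eta>)"
    using ext_variance_lower_approx[OF P ac I \<Lambda> \<open>\<delta> > 0\<close>] by blast
  then obtain \<eta> where \<eta>: "\<And>x. x \<in> K \<Longrightarrow> 0 < \<eta> x"
      "\<And>x. x \<in> K \<Longrightarrow> ?V xm < integral\<^sup>L P (?h x (\<eta> x))"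
    by metis
  obtain F where F: "finite F" "F \<subseteq> K" "K \<subseteq> (\<Union>x\<in>F. centroid_ball I \<delta> x (\<eta> x))"
    using finite_centroid_ball_cover[OF I K \<eta>(1)] .
  obtain b where b: "\<And>x w. x \<in> ?D \<Longrightarrow> ext_loss I \<Lambda> x w \<le> b"
    using ext_loss_bounded[OF \<Lambda>] by metis
  have "AE s in M. ?avg (?h x (\<eta> x)) s \<longlonglongrightarrow> integral\<^sup>L P (?h x (\<eta> x))" if "x \<in> F" for x
  proof (rule bounded_strong_law_comp[OF assms(5,6)])
    have "x \<in> ?D" "x \<in> centroid_ball I \<delta> x (\<eta> x)"
      using that F(2) \<open>K \<subseteq> ?D\<close> \<eta>(1) by (auto intro!: mem_centroid_ball_self)
    then show "?h x (\<eta> x) w \<in> {0..b}" for w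
      using minorant_loss_nonneg[OF \<Lambda>] minorant_loss_le_ext_loss[OF \<Lambda>] b
      by (meson atLeastAtMost_iff order_trans)
  qed (auto intro: borel_measurable_minorant_loss[OF I])
  \<comment> \<open>Finiteness of the cover gives one null set for all the minorants.\<close>
  then have "AE s in M. \<forall>x\<in>F. ?avg (?h x (\<eta> x)) s \<longlonglongrightarrow> integral\<^sup>L P (?h x (\<eta> x))"
    using F(1) by (intro AE_finite_allI) auto
  moreover have "AE s in M. ?avg (ext_loss I \<Lambda> xm) s \<longlonglongrightarrow> integral\<^sup>L P (ext_loss I \<Lambda> xm)"
  proof (rule bounded_strong_law_comp[OF assms(5,6)])
    show "ext_loss I \<Lambda> xm w \<in> {0..b}" for w
      using ext_loss_nonneg[OF \<Lambda>] b[OF xmD] by auto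
  qed (auto intro: borel_measurable_ext_loss[OF I])
  ultimately show ?thesis
  proof eventually_elim
    case (elim s)
    have V: "?avg (ext_loss I \<Lambda> xm) s \<longlonglongrightarrow> ?V xm"
      using elim(2) ext_variance_eq[OF P I xmD] by simp
    have \<beta>: "(\<lambda>n. 1 / \<beta> n) \<longlonglongrightarrow> 0"
      using assms(13) by (intro tendsto_divide_0[OF tendsto_const] filterlim_at_top_imp_at_infinity)
    \<comment> \<open>The difference of the two sides tends to the positive gap between the mean of
      the minorant and the minimum, because the tolerance \<open>1 / \<beta> n\<close>
      vanishes.\<close>
    have "\<forall>\<^sub>F n in sequentially. \<forall>x\<in>F. ?avg (ext_loss I \<Lambda> xm) s n + 1 / \<beta> n < ?avg (?h x (\<eta> x)) s n"
    proof (rule eventually_ball_finite[OF F(1)], rule ballI)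
      fix x assume x: "x \<in> F"
      have "(\<lambda>n. ?avg (?h x (\<eta> x)) s n - (?avg (ext_loss I \<Lambda> xm) s n + 1 / \<beta> n))
          \<longlonglongrightarrow> integral\<^sup>L P (?h x (\<eta> x)) - (?V xm + 0)"
        using elim(1) x by (intro tendsto_intros V \<beta>) auto
      moreover have "0 < integral\<^sup>L P (?h x (\<eta> x)) - (?V xm + 0)"
        using \<eta>(2) x F(2) by auto
      ultimately have "\<forall>\<^sub>F n in sequentially.
          0 < ?avg (?h x (\<eta> x)) s n - (?avg (ext_loss I \<Lambda> xm) s n + 1 / \<beta> n)"
        using order_tendstoD(1) by blast
      then show "\<forall>\<^sub>F n in sequentially. ?avg (ext_loss I \<Lambda> xm) s n + 1 / \<beta> n < ?avg (?h x (\<eta> x)) s n"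
        by eventually_elim simp
    qed
    then obtain n0 where n0: "\<And>n x. n \<ge> n0 \<Longrightarrow> x \<in> F \<Longrightarrow>
        ?avg (ext_loss I \<Lambda> xm) s n + 1 / \<beta> n < ?avg (?h x (\<eta> x)) s n"
      by (auto simp: eventually_sequentially)
    have "quasi_estimators I \<delta> \<Lambda> \<beta> (\<lambda>k. \<omega> k s) n \<subseteq> N" if n: "n \<ge> n0" for n
    proof
      fix y assume y: "y \<in> quasi_estimators I \<delta> \<Lambda> \<beta> (\<lambda>k. \<omega> k s) n"
      show "y \<in> N"
      proof (rule ccontr)
        assume "y \<notin> N"
        then have "y \<in> K"
          using y U(3) by (auto simp: K_def quasi_estimators_def)
        then obtain x where x: "x \<in> F" "y \<in> centroid_ball I \<delta> x (\<eta> x)"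
          using F(3) by blast
        \<comment> \<open>A real infimum is a lower bound only for a set bounded below;
          nonnegativity provides this.\<close>
        have "bdd_below (?Vn s n ` ?D)"
          using emp_ext_variance_nonneg[OF I \<Lambda>] by (intro bdd_belowI2[where m = 0])
        \<comment> \<open>The infimum is compared with the value at the true minimizer
          \<open>xm\<close>; through the minorant of the ball containing \<open>y\<close>, the chain
          ends above the threshold that \<open>y\<close> must stay below.\<close>
        then have "(INF z\<in>?D. ?Vn s n z) + 1 / \<beta> n \<le> ?Vn s n xm + 1 / \<beta> n"
          using cINF_lower[OF _ xmD] by (intro add_right_mono)
        also have "\<dots> < ?avg (?h x (\<eta> x)) s n"
          using n0[OF n x(1)] by (simp add: emp_ext_variance_eq[OF I])
        also have "\<dots> \<le> ?Vn s n y"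
          unfolding emp_ext_variance_eq[OF I]
          by (intro divide_right_mono sum_mono minorant_loss_le_ext_loss[OF \<Lambda> x(2)]) simp
        finally show False
          using y by (simp add: quasi_estimators_def)
      qed
    qed
    then show ?case by blast
  qed
qed

end
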